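(* Let $k,t$ be fixed positive integers with $t\ge k$. Then $$\mathrm{satex}(n,\,P_{2k+1}:\,m,\,K_{2,t})=\Omega\left(n^2\left(\frac{m}{n^{k+1}}\right)^{t/k}\right),$$ provided that $m=m(n)\gg n^{k+1}$.
   Context: All graphs are finite and simple. $P_{2k+1}$ denotes the path on $2k+1$ vertices and $K_{2,t}$ the complete bipartite graph with parts of sizes $2$ and $t$. A copy of a graph is a (not necessarily induced) subgraph isomorphic to it. $\mathrm{satex}(n,F:m,G)$ denotes the minimum number of copies of $G$ in an $n$-vertex graph having at least $m$ copies of $F$ (considered when such a graph exists). $f(n)\gg g(n)$ means $f(n)/g(n)\to\infty$ as $n\to\infty$; the constant implied by $\Omega$ may depend on the fixed parameters $k,t$, and asymptotics are for $n\to\infty$. *)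

theory Defs
  imports Complex_Main
begin

datatype 'a sgraph = SGraph (verts: "'a set") (edges: "'a set set")

definition finite_simple_graph :: "'a sgraph \<Rightarrow> bool" where
  "finite_simple_graph G \<longleftrightarrow>
     finite (verts G) \<and> (\<forall>e\<in>edges G. e \<subseteq> verts G \<and> card e = 2)"

definition subgraph :: "'a sgraph \<Rightarrow> 'a sgraph \<Rightarrow> bool" where
  "subgraph H G \<longleftrightarrow> finite_simple_graph H \<and> verts H \<subseteq> verts G \<and> edges H \<subseteq> edges G"

definition isomorphic :: "'a sgraph \<Rightarrow> 'b sgraph \<Rightarrow> bool" where
  "isomorphic F H \<longleftrightarrow>
     (\<exists>\<phi>. bij_betw \<phi> (verts F) (verts H) \<and> (\<lambda>e. \<phi> ` e) ` edges F = edges H)"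

text \<open>Copies are subgraphs, not embeddings: automorphisms of the pattern graph do not
  lead to multiple counting.\<close>

definition num_copies :: "'a sgraph \<Rightarrow> 'b sgraph \<Rightarrow> nat" where
  "num_copies F G = card {H. subgraph H G \<and> isomorphic F H}"

definition path_graph :: "nat \<Rightarrow> nat sgraph" where
  "path_graph l = SGraph {..<l} {{i, Suc i} |i. Suc i < l}"

definition complete_bipartite :: "nat \<Rightarrow> nat \<Rightarrow> (nat + nat) sgraph" where
  "complete_bipartite s t =
     SGraph ({..<s} <+> {..<t}) {{Inl i, Inr j} |i j. i < s \<and> j < t}"

text \<open>Taking the vertices to be natural numbers loses no generality, as every finite
  graph is isomorphic to one of this form.\<close>

definition satex_graphs :: "nat \<Rightarrow> 'a sgraph \<Rightarrow> nat \<Rightarrow> nat sgraph set" where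
  "satex_graphs n F m =
     {G. finite_simple_graph G \<and> card (verts G) = n \<and> m \<le> num_copies F G}"

text \<open>The infimum is an attained minimum when \<open>satex_graphs n F m\<close> is nonempty; otherwise
  it has the junk value 0.\<close>

definition satex :: "nat \<Rightarrow> 'a sgraph \<Rightarrow> nat \<Rightarrow> 'b sgraph \<Rightarrow> nat" where
  "satex n F m H = (INF G \<in> satex_graphs n F m. num_copies H G)"

end

theory Submission imports Defs "HOL-Library.FuncSet" begin

text \<open>
  Split a path on \<open>2 * k + 1\<close> vertices into its \<open>k + 1\<close> vertices at even positions and its
  \<open>k\<close> vertices at odd positions. Each odd vertex is a common neighbour of the two even vertices
  around it, so the even vertices \<open>u\<^sub>0, \<dots>, u\<^sub>k\<close> extend to at most \<open>\<Prod>i<k. d(u\<^sub>i, u\<^sub>i\<^sub>+\<^sub>1)\<close>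
  paths, where \<open>d\<close> is the codegree. A product of \<open>k\<close> numbers is at most the sum of their
  \<open>k\<close>-th powers, and a pair occupies two given consecutive even positions in at most
  \<open>n ^ (k - 1)\<close> tuples. Hence many paths force a large \<open>k\<close>-th moment of the codegree
  (\<open>path_copies_le_codegree_moment\<close>): the average of \<open>d ^ k\<close> over the \<open>n\<^sup>2\<close> ordered pairs is at
  least \<open>m / (k * n ^ (k + 1))\<close>.

  On the other side, a pair of distinct vertices lies in \<open>d choose t\<close> copies of \<open>K\<^bsub>2,t\<^esub>\<close> as the
  part of size two, and a copy arises from a bounded number of pairs
  (\<open>sum_binomial_codegree_le_copies\<close>).

  Let \<open>B\<close> be half of the lower bound for the average of \<open>d ^ k\<close>. Pairs with \<open>d ^ k < B\<close> account
  for at most half of the \<open>k\<close>-th moment, so the others contribute at least \<open>n\<^sup>2 * B\<close>. For those,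
  \<open>d ^ t\<close> exceeds \<open>d ^ k\<close> by a factor of at least \<open>B powr (t / k - 1)\<close>, so that their \<open>t\<close>-th
  moment is at least \<open>n\<^sup>2 * B powr (t / k)\<close>. The growth condition on \<open>m\<close> makes \<open>B\<close> tend to
  infinity, hence \<open>d \<ge> t\<close> for those pairs, and then \<open>d choose t\<close> is of order \<open>d ^ t\<close>
  (\<open>sum_binomial_ge\<close>).
\<close>

section \<open>Common neighbours\<close>

definition common_nbrs :: "'a sgraph \<Rightarrow> 'a \<Rightarrow> 'a \<Rightarrow> 'a set" where
  "common_nbrs G u v = {w. {u, w} \<in> edges G \<and> {w, v} \<in> edges G}"

definition codegree :: "'a sgraph \<Rightarrow> 'a \<Rightarrow> 'a \<Rightarrow> nat" where
  "codegree G u v = card (common_nbrs G u v)"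

definition distinct_pairs :: "'a sgraph \<Rightarrow> ('a \<times> 'a) set" where
  "distinct_pairs G = {(u, v). u \<in> verts G \<and> v \<in> verts G \<and> u \<noteq> v}"

lemma edge_endpoints:
  assumes "finite_simple_graph G" "{u, w} \<in> edges G"
  shows "u \<in> verts G" "w \<in> verts G" "u \<noteq> w"
  using assms by (auto simp: finite_simple_graph_def)

lemma common_nbrs_subset:
  assumes "finite_simple_graph G"
  shows "common_nbrs G u v \<subseteq> verts G"
  using edge_endpoints[OF assms] by (auto simp: common_nbrs_def)

lemma finite_common_nbrs:
  assumes "finite_simple_graph G"
  shows "finite (common_nbrs G u v)"
  using common_nbrs_subset[OF assms] assms by (auto simp: finite_simple_graph_def intro: finite_subset)

lemma finite_distinct_pairs:
  assumes "finite_simple_graph G"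
  shows "finite (distinct_pairs G)"
  by (rule finite_subset[of _ "verts G \<times> verts G"])
     (use assms in \<open>auto simp: distinct_pairs_def finite_simple_graph_def\<close>)

lemma card_distinct_pairs_le:
  assumes "finite_simple_graph G"
  shows "card (distinct_pairs G) \<le> card (verts G) ^ 2"
proof -
  have "card (distinct_pairs G) \<le> card (verts G \<times> verts G)"
    by (rule card_mono) (use assms in \<open>auto simp: distinct_pairs_def finite_simple_graph_def\<close>)
  thus ?thesis by (simp add: card_cartesian_product power2_eq_square)
qed

section \<open>Paths and the moments of the codegree\<close>

text \<open>The largest factor already dominates: its \<open>k\<close>-th power occurs in the sum. Losing a factor
  \<open>k\<close> against the inequality of arithmetic and geometric means only changes constants.\<close>

lemma prod_le_sum_powers:
  fixes x :: "nat \<Rightarrow> nat"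
  assumes "1 \<le> k"
  shows "(\<Prod>i<k. x i) \<le> (\<Sum>i<k. x i ^ k)"
proof -
  define M where "M = Max (x ` {..<k})"
  have ne: "x ` {..<k} \<noteq> {}" using assms by (auto simp: lessThan_empty_iff)
  have "M \<in> x ` {..<k}" unfolding M_def using ne by (intro Max_in) auto
  then obtain j where j: "j < k" "M = x j" by auto
  have "(\<Prod>i<k. x i) \<le> (\<Prod>i<k. M)"
    by (rule prod_mono) (auto simp: M_def)
  also have "\<dots> = x j ^ k" using j by simp
  also have "\<dots> \<le> (\<Sum>i<k. x i ^ k)"
    using j by (intro member_le_sum) auto
  finally show ?thesis .
qed

lemma card_PiE_two_fixed:
  assumes "finite V" "i < k" "a \<in> V" "b \<in> V"
  shows "card {u \<in> {..k} \<rightarrow>\<^sub>E V. u i = a \<and> u (Suc i) = b} \<le> card V ^ (k - 1)"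
proof -
  define A where "A = (\<lambda>j. if j = i then {a} else if j = Suc i then {b} else V)"
  have "{u \<in> {..k} \<rightarrow>\<^sub>E V. u i = a \<and> u (Suc i) = b} \<subseteq> Pi\<^sub>E {..k} A"
    by (auto simp: A_def PiE_iff extensional_def)
  moreover have "finite (Pi\<^sub>E {..k} A)"
    by (rule finite_PiE) (use assms in \<open>auto simp: A_def\<close>)
  ultimately have "card {u \<in> {..k} \<rightarrow>\<^sub>E V. u i = a \<and> u (Suc i) = b} \<le> card (Pi\<^sub>E {..k} A)"
    by (simp add: card_mono)
  also have "\<dots> = (\<Prod>j\<le>k. card (A j))" by (simp add: card_PiE)
  also have "\<dots> = (\<Prod>j\<in>{..k} - {i, Suc i}. card (A j))"
    by (rule prod.mono_neutral_right) (use assms in \<open>auto simp: A_def\<close>)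
  also have "\<dots> = (\<Prod>j\<in>{..k} - {i, Suc i}. card V)"
    by (intro prod.cong) (auto simp: A_def)
  also have "\<dots> = card V ^ (k - 1)"
    using assms by (simp add: card_Diff_subset)
  finally show ?thesis .
qed

lemma sum_consecutive_le:
  fixes g :: "'a \<times> 'a \<Rightarrow> nat"
  assumes "finite V" "i < k" "finite P" "P \<subseteq> V \<times> V"
    and U: "U \<subseteq> {..k} \<rightarrow>\<^sub>E V" "\<And>u. u \<in> U \<Longrightarrow> (u i, u (Suc i)) \<in> P"
  shows "(\<Sum>u\<in>U. g (u i, u (Suc i))) \<le> card V ^ (k - 1) * (\<Sum>p\<in>P. g p)"
proof -
  let ?h = "\<lambda>u::nat \<Rightarrow> 'a. (u i, u (Suc i))"
  have finE: "finite ({..k} \<rightarrow>\<^sub>E V)" using assms(1) by (intro finite_PiE) auto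
  hence finU: "finite U" using U(1) finite_subset by blast
  have "(\<Sum>u\<in>U. g (?h u)) = (\<Sum>p\<in>P. \<Sum>u\<in>{u \<in> U. ?h u = p}. g (?h u))"
    by (rule sum.group[symmetric]) (use finU assms in auto)
  also have "\<dots> = (\<Sum>p\<in>P. card {u \<in> U. ?h u = p} * g p)"
    by (intro sum.cong refl) simp
  also have "\<dots> \<le> (\<Sum>p\<in>P. card V ^ (k - 1) * g p)"
  proof (intro sum_mono mult_right_mono)
    fix p assume "p \<in> P"
    then obtain a b where p: "p = (a, b)" "a \<in> V" "b \<in> V" using assms(4) by auto
    have "card {u \<in> U. ?h u = p} \<le> card {u \<in> {..k} \<rightarrow>\<^sub>E V. u i = a \<and> u (Suc i) = b}"
      by (rule card_mono) (use finE U(1) p in auto)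
    also have "\<dots> \<le> card V ^ (k - 1)" using assms(1,2) p(2,3) by (rule card_PiE_two_fixed)
    finally show "card {u \<in> U. ?h u = p} \<le> card V ^ (k - 1)" .
  qed simp
  finally show ?thesis by (simp add: sum_distrib_left)
qed

text \<open>The maps counted here are the labelled paths. Being extensional, they form a finite set
  although their domain type is infinite.\<close>

definition path_embeddings :: "nat \<Rightarrow> 'a sgraph \<Rightarrow> (nat \<Rightarrow> 'a) set" where
  "path_embeddings l G =
     {f \<in> {..<l} \<rightarrow>\<^sub>E verts G. inj_on f {..<l} \<and> (\<forall>i. Suc i < l \<longrightarrow> {f i, f (Suc i)} \<in> edges G)}"

lemma finite_path_embeddings:
  assumes "finite_simple_graph G"
  shows "finite (path_embeddings l G)"
  by (rule finite_subset[of _ "{..<l} \<rightarrow>\<^sub>E verts G"])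
     (use assms in \<open>auto simp: path_embeddings_def finite_simple_graph_def intro!: finite_PiE\<close>)

lemma path_copies_le_embeddings:
  assumes G: "finite_simple_graph G"
  shows "num_copies (path_graph l) G \<le> card (path_embeddings l G)"
proof -
  let ?P = "path_graph l"
  let ?F = "\<lambda>f. SGraph (f ` verts ?P) ((\<lambda>e. f ` e) ` edges ?P)"
  have "{H. subgraph H G \<and> isomorphic ?P H} \<subseteq> ?F ` path_embeddings l G"
  proof safe
    fix H assume sub: "subgraph H G" and "isomorphic ?P H"
    then obtain \<phi> where \<phi>: "bij_betw \<phi> (verts ?P) (verts H)" "(\<lambda>e. \<phi> ` e) ` edges ?P = edges H"
      by (auto simp: isomorphic_def)
    let ?f = "restrict \<phi> {..<l}"
    have "(\<lambda>e. ?f ` e) ` edges ?P = (\<lambda>e. \<phi> ` e) ` edges ?P"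
      by (intro image_cong refl) (auto simp: path_graph_def)
    moreover have "?f ` verts ?P = \<phi> ` verts ?P" by (auto simp: path_graph_def)
    ultimately have F: "?F ?f = H" using \<phi> by (cases H) (auto simp: bij_betw_def)
    have edge: "{\<phi> i, \<phi> (Suc i)} \<in> edges G" if "Suc i < l" for i
    proof -
      have "{i, Suc i} \<in> edges ?P" using that by (auto simp: path_graph_def)
      hence "\<phi> ` {i, Suc i} \<in> edges H" using \<phi>(2) by blast
      thus ?thesis using sub by (auto simp: subgraph_def)
    qed
    have "\<phi> ` {..<l} \<subseteq> verts G" "inj_on \<phi> {..<l}"
      using \<phi>(1) sub by (auto simp: bij_betw_def path_graph_def subgraph_def)
    hence "?f \<in> path_embeddings l G"
      using edge by (auto simp: path_embeddings_def inj_on_def)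
    thus "H \<in> ?F ` path_embeddings l G" using F by (intro image_eqI[where x = ?f]) auto
  qed
  thus ?thesis unfolding num_copies_def
    using surj_card_le[OF finite_path_embeddings[OF G]] by blast
qed

text \<open>Injectivity of a path enters only here, and only through consecutive even vertices being
  distinct; this is what keeps the degrees (the codegrees on the diagonal) out of the estimate.\<close>

lemma path_copies_le_codegree_moment:
  assumes G: "finite_simple_graph G" and k: "1 \<le> k"
  shows "num_copies (path_graph (2 * k + 1)) G
           \<le> k * card (verts G) ^ (k - 1) * (\<Sum>(u, v)\<in>distinct_pairs G. codegree G u v ^ k)"
proof -
  let ?V = "verts G"
  define U where "U = {u \<in> {..k} \<rightarrow>\<^sub>E ?V. \<forall>i<k. u i \<noteq> u (Suc i)}"
  define S where "S = Sigma U (\<lambda>u. \<Pi>\<^sub>E i\<in>{..<k}. common_nbrs G (u i) (u (Suc i)))"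
  define split where
    "split = (\<lambda>f::nat \<Rightarrow> 'a. (restrict (\<lambda>i. f (2 * i)) {..k}, restrict (\<lambda>i. f (2 * i + 1)) {..<k}))"
  have finV: "finite ?V" using G by (simp add: finite_simple_graph_def)
  have finE: "finite ({..k} \<rightarrow>\<^sub>E ?V)" using finV by (intro finite_PiE) auto
  hence finU: "finite U" by (simp add: U_def)
  have finN: "finite (\<Pi>\<^sub>E i\<in>{..<k}. common_nbrs G (u i) (u (Suc i)))" for u
    by (intro finite_PiE) (auto simp: finite_common_nbrs[OF G])
  have "inj_on split (path_embeddings (2 * k + 1) G)"
  proof (rule inj_onI)
    fix f g assume fg: "f \<in> path_embeddings (2 * k + 1) G" "g \<in> path_embeddings (2 * k + 1) G"
      and eq: "split f = split g"
    have even: "f (2 * i) = g (2 * i)" if "i \<le> k" for i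
      using fun_cong[OF arg_cong[OF eq, of fst], of i] that by (simp add: split_def)
    have odd: "f (2 * i + 1) = g (2 * i + 1)" if "i < k" for i
      using fun_cong[OF arg_cong[OF eq, of snd], of i] that by (simp add: split_def)
    show "f = g"
    proof (rule PiE_ext)
      show "f \<in> {..<2 * k + 1} \<rightarrow>\<^sub>E ?V" "g \<in> {..<2 * k + 1} \<rightarrow>\<^sub>E ?V"
        using fg by (auto simp: path_embeddings_def)
      fix j assume "j \<in> {..<2 * k + 1}"
      thus "f j = g j"
        using even[of "j div 2"] odd[of "j div 2"] by (cases "even j") (auto elim!: evenE oddE)
    qed
  qed
  moreover have "split ` path_embeddings (2 * k + 1) G \<subseteq> S"
  proof (rule image_subsetI)
    fix f assume f: "f \<in> path_embeddings (2 * k + 1) G"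
    have inj: "f a \<noteq> f b" if "a \<noteq> b" "a < 2 * k + 1" "b < 2 * k + 1" for a b
      using f that by (auto simp: path_embeddings_def inj_on_def)
    have edge: "{f a, f (Suc a)} \<in> edges G" if "Suc a < 2 * k + 1" for a
      using f that by (auto simp: path_embeddings_def)
    have ver: "f a \<in> ?V" if "a < 2 * k + 1" for a
      using f that by (auto simp: path_embeddings_def)
    have "restrict (\<lambda>i. f (2 * i)) {..k} \<in> U"
      using ver inj by (auto simp: U_def)
    moreover have "f (2 * i + 1) \<in> common_nbrs G (f (2 * i)) (f (2 * Suc i))" if "i < k" for i
      using edge[of "2 * i"] edge[of "2 * i + 1"] that by (auto simp: common_nbrs_def)
    ultimately show "split f \<in> S" by (auto simp: S_def split_def)
  qed
  moreover have "finite S" unfolding S_def using finU finN by auto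
  ultimately have "card (path_embeddings (2 * k + 1) G) \<le> card S" by (rule card_inj_on_le)
  also have "card S = (\<Sum>u\<in>U. \<Prod>i<k. codegree G (u i) (u (Suc i)))"
    unfolding S_def using finU finN by (subst card_SigmaI) (auto simp: card_PiE codegree_def)
  also have "\<dots> \<le> (\<Sum>u\<in>U. \<Sum>i<k. codegree G (u i) (u (Suc i)) ^ k)"
    by (intro sum_mono prod_le_sum_powers k)
  also have "\<dots> = (\<Sum>i<k. \<Sum>u\<in>U. codegree G (u i) (u (Suc i)) ^ k)"
    by (rule sum.swap)
  also have "\<dots> \<le> (\<Sum>i<k. card ?V ^ (k - 1) * (\<Sum>(u, v)\<in>distinct_pairs G. codegree G u v ^ k))"
  proof (rule sum_mono)
    fix i assume i: "i \<in> {..<k}"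
    have "U \<subseteq> {..k} \<rightarrow>\<^sub>E ?V" by (auto simp: U_def)
    moreover have "(u i, u (Suc i)) \<in> distinct_pairs G" if "u \<in> U" for u
      using that i by (auto simp: U_def distinct_pairs_def)
    moreover have "distinct_pairs G \<subseteq> ?V \<times> ?V" by (auto simp: distinct_pairs_def)
    ultimately show "(\<Sum>u\<in>U. codegree G (u i) (u (Suc i)) ^ k)
        \<le> card ?V ^ (k - 1) * (\<Sum>(u, v)\<in>distinct_pairs G. codegree G u v ^ k)"
      using sum_consecutive_le[of ?V i k "distinct_pairs G" U "\<lambda>(u, v). codegree G u v ^ k"]
        finV i finite_distinct_pairs[OF G] by simp
  qed
  also have "\<dots> = k * card ?V ^ (k - 1) * (\<Sum>(u, v)\<in>distinct_pairs G. codegree G u v ^ k)"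
    by simp
  finally show ?thesis using path_copies_le_embeddings[OF G, of "2 * k + 1"] by linarith
qed

section \<open>Codegrees and complete bipartite graphs\<close>

lemma finite_copies:
  assumes "finite_simple_graph G"
  shows "finite {H. subgraph H G \<and> isomorphic F H}"
proof (rule finite_subset)
  have fin: "finite (verts G)" and "edges G \<subseteq> Pow (verts G)"
    using assms by (auto simp: finite_simple_graph_def)
  hence "finite (edges G)" by (meson finite_Pow_iff finite_subset)
  with fin show "finite ((\<lambda>(A, B). SGraph A B) ` (Pow (verts G) \<times> Pow (edges G)))" by simp
  show "{H. subgraph H G \<and> isomorphic F H} \<subseteq> (\<lambda>(A, B). SGraph A B) ` (Pow (verts G) \<times> Pow (edges G))"
  proof safe
    fix H assume "subgraph H G"
    thus "H \<in> (\<lambda>(A, B). SGraph A B) ` (Pow (verts G) \<times> Pow (edges G))"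
      by (cases H) (auto simp: subgraph_def image_iff)
  qed
qed

definition bipartite_on :: "'a \<Rightarrow> 'a \<Rightarrow> 'a set \<Rightarrow> 'a sgraph" where
  "bipartite_on u v T = SGraph ({u, v} \<union> T) ((\<lambda>w. {u, w}) ` T \<union> (\<lambda>w. {v, w}) ` T)"

lemma bipartite_on_copy:
  assumes G: "finite_simple_graph G" and "u \<in> verts G" "v \<in> verts G" "u \<noteq> v"
    and T: "T \<subseteq> common_nbrs G u v" "card T = t"
  shows "subgraph (bipartite_on u v T) G" "isomorphic (complete_bipartite 2 t) (bipartite_on u v T)"
proof -
  have finT: "finite T" using T(1) finite_common_nbrs[OF G] finite_subset by blast
  have nb: "{u, w} \<in> edges G" "{v, w} \<in> edges G" if "w \<in> T" for w
    using T(1) that by (auto simp: common_nbrs_def insert_commute)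
  have out: "w \<in> verts G" "u \<noteq> w" "v \<noteq> w" if "w \<in> T" for w
    using nb[OF that] edge_endpoints[OF G] by blast+
  show "subgraph (bipartite_on u v T) G"
    using assms finT nb out by (auto simp: subgraph_def bipartite_on_def finite_simple_graph_def)
  obtain h where h: "bij_betw h {..<t} T"
    using ex_bij_betw_nat_finite[OF finT] T(2) by (auto simp: atLeast0LessThan)
  define \<phi> where "\<phi> = (\<lambda>x. case x of Inl i \<Rightarrow> (if i = (0::nat) then u else v) | Inr j \<Rightarrow> h j)"
  have two: "{..<2} = {0, 1::nat}" by auto
  have hT: "h ` {..<t} = T" "inj_on h {..<t}" using h by (auto simp: bij_betw_def)
  have "bij_betw \<phi> ({..<2} <+> {..<t}) ({u, v} \<union> T)"
    unfolding bij_betw_def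
  proof
    show "inj_on \<phi> ({..<2} <+> {..<t})"
      using assms(4) out hT by (fastforce simp: inj_on_def \<phi>_def two)
    show "\<phi> ` ({..<2} <+> {..<t}) = {u, v} \<union> T"
      using hT(1) unfolding two by (auto simp: \<phi>_def Plus_def image_Un image_image)
  qed
  moreover have "(\<lambda>e. \<phi> ` e) ` {{Inl i, Inr j} |i j. i < 2 \<and> j < t}
      = (\<lambda>w. {u, w}) ` T \<union> (\<lambda>w. {v, w}) ` T"
  proof -
    have "{{Inl i, Inr j} |i j. i < 2 \<and> j < t}
        = (\<lambda>j. {Inl (0::nat), Inr j}) ` {..<t} \<union> (\<lambda>j. {Inl 1, Inr j}) ` {..<t}"
      by (auto simp: less_2_cases_iff)
    thus ?thesis by (simp add: image_Un image_image \<phi>_def flip: hT(1))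
  qed
  ultimately show "isomorphic (complete_bipartite 2 t) (bipartite_on u v T)"
    by (auto simp: isomorphic_def complete_bipartite_def bipartite_on_def)
qed

text \<open>A copy with vertex set \<open>X\<close> determines \<open>T\<close> as \<open>X - {u, v}\<close>, so it arises from at most
  one triple \<open>(u, v, T)\<close> for each pair in \<open>X \<times> X\<close>. The crude count \<open>(t + 2)\<^sup>2\<close> also covers
  \<open>t = 2\<close>, where the two parts can be exchanged.\<close>

lemma sum_binomial_codegree_le_copies:
  assumes G: "finite_simple_graph G"
  shows "(\<Sum>(u, v)\<in>distinct_pairs G. codegree G u v choose t)
           \<le> (t + 2) ^ 2 * num_copies (complete_bipartite 2 t) G"
proof -
  let ?C = "{H. subgraph H G \<and> isomorphic (complete_bipartite 2 t) H}"
  define S where "S = Sigma (distinct_pairs G) (\<lambda>(u, v). {T. T \<subseteq> common_nbrs G u v \<and> card T = t})"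
  define R where "R = Sigma {H \<in> ?C. finite (verts H) \<and> card (verts H) = t + 2} (\<lambda>H. verts H \<times> verts H)"
  have finX: "finite {H \<in> ?C. finite (verts H) \<and> card (verts H) = t + 2}"
    by (rule finite_subset[OF _ finite_copies[OF G, of "complete_bipartite 2 t"]]) auto
  define F where "F = (\<lambda>((u, v), T). (bipartite_on u v T, (u, v :: 'a)))"
  have disj: "u \<notin> T" "v \<notin> T" if "T \<subseteq> common_nbrs G u v" for u v T
    using that edge_endpoints(3)[OF G] unfolding common_nbrs_def by blast+
  have "inj_on F S"
  proof (rule inj_onI, clarsimp simp: F_def S_def)
    fix u v T T'
    assume "T \<subseteq> common_nbrs G u v" "T' \<subseteq> common_nbrs G u v"
      and eq: "bipartite_on u v T = bipartite_on u v T'"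
    hence "{u, v} \<inter> T = {}" "{u, v} \<inter> T' = {}" using disj by blast+
    moreover have "{u, v} \<union> T = {u, v} \<union> T'" using eq by (simp add: bipartite_on_def)
    ultimately show "T = T'" by blast
  qed
  moreover have "F ` S \<subseteq> R"
  proof (clarsimp simp: F_def S_def R_def)
    fix u v T assume uv: "(u, v) \<in> distinct_pairs G" and T: "T \<subseteq> common_nbrs G u v" "t = card T"
    have "finite T" using T(1) finite_common_nbrs[OF G] finite_subset by blast
    thus "subgraph (bipartite_on u v T) G \<and>
        isomorphic (complete_bipartite 2 (card T)) (bipartite_on u v T) \<and>
        finite (verts (bipartite_on u v T)) \<and>
        card (verts (bipartite_on u v T)) = Suc (Suc (card T)) \<and>
        u \<in> verts (bipartite_on u v T) \<and> v \<in> verts (bipartite_on u v T)"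
      using bipartite_on_copy[OF G, of u v T] uv T disj[OF T(1)]
      by (auto simp: distinct_pairs_def bipartite_on_def)
  qed
  moreover have "finite R" unfolding R_def using finX by (intro finite_SigmaI) auto
  ultimately have "card S \<le> card R" by (rule card_inj_on_le)
  moreover have "card R \<le> (t + 2) ^ 2 * num_copies (complete_bipartite 2 t) G"
  proof -
    have "card R = (\<Sum>H\<in>{H \<in> ?C. finite (verts H) \<and> card (verts H) = t + 2}. (t + 2) ^ 2)"
      unfolding R_def using finX
      by (subst card_SigmaI) (auto simp: card_cartesian_product power2_eq_square intro!: sum.cong)
    also have "\<dots> \<le> (t + 2) ^ 2 * card ?C"
      using finite_copies[OF G] by (auto intro!: card_mono)
    finally show ?thesis by (simp add: num_copies_def)
  qed
  moreover have "card S = (\<Sum>(u, v)\<in>distinct_pairs G. codegree G u v choose t)"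
    unfolding S_def using finite_distinct_pairs[OF G] finite_common_nbrs[OF G]
    by (subst card_SigmaI) (auto simp: n_subsets codegree_def intro!: sum.cong)
  ultimately show ?thesis by simp
qed

section \<open>From the lower moment to the higher one\<close>

text \<open>A threshold replaces the power mean inequality. It keeps only summands with \<open>d p \<ge> t\<close>,
  for which \<open>d p choose t\<close> is comparable to \<open>d p ^ t\<close>, so no lower-order terms remain.\<close>

lemma sum_binomial_ge:
  fixes d :: "'p \<Rightarrow> nat" and B N :: real
  assumes "finite P" "real (card P) \<le> N" and k: "1 \<le> k" "k \<le> t"
    and B: "real t ^ k \<le> B" and moment: "2 * N * B \<le> (\<Sum>p\<in>P. real (d p) ^ k)"
  shows "N * B powr (real t / real k) \<le> real t ^ t * (\<Sum>p\<in>P. real (d p choose t))"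
proof -
  define Q where "Q = {p \<in> P. B \<le> real (d p) ^ k}"
  have "0 < real t ^ k" using k by simp
  hence Bpos: "0 < B" using B by linarith
  have "(\<Sum>p\<in>P - Q. real (d p) ^ k) \<le> (\<Sum>p\<in>P - Q. B)"
    by (intro sum_mono) (auto simp: Q_def)
  also have "\<dots> \<le> card P * B"
    using assms(1) Bpos by (auto intro!: card_mono)
  also have "\<dots> \<le> N * B" using assms(2) Bpos by (intro mult_right_mono) auto
  finally have small: "(\<Sum>p\<in>P - Q. real (d p) ^ k) \<le> N * B" .
  have "(\<Sum>p\<in>P. real (d p) ^ k) = (\<Sum>p\<in>P - Q. real (d p) ^ k) + (\<Sum>p\<in>Q. real (d p) ^ k)"
    by (rule sum.subset_diff) (use assms(1) in \<open>auto simp: Q_def\<close>)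
  hence large: "N * B \<le> (\<Sum>p\<in>Q. real (d p) ^ k)" using small moment by linarith
  have binom: "real (d p) ^ k * B powr (real t / real k - 1) \<le> real t ^ t * real (d p choose t)"
    if "p \<in> Q" for p
  proof -
    have dB: "B \<le> real (d p) ^ k" using that by (simp add: Q_def)
    hence "real t ^ k \<le> real (d p) ^ k" using B by linarith
    hence td: "t \<le> d p" using k by (simp add: power_mono_iff)
    hence dpos: "0 < real (d p)" using k by simp
    have "B powr (real t / real k - 1) \<le> (real (d p) ^ k) powr (real t / real k - 1)"
      using dB Bpos k by (intro powr_mono2) (auto simp: field_simps)
    also have "\<dots> = real (d p) powr (real t - real k)"
      using dpos k by (simp add: powr_powr right_diff_distrib flip: powr_realpow)
    also have "\<dots> = real (d p) ^ (t - k)"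
      using dpos k by (simp add: powr_realpow flip: of_nat_diff)
    finally have "real (d p) ^ k * B powr (real t / real k - 1) \<le> real (d p) ^ k * real (d p) ^ (t - k)"
      by (intro mult_left_mono) auto
    also have "\<dots> = real (d p) ^ t" using k by (simp flip: power_add)
    also have "\<dots> = real t ^ t * (real (d p) / real t) ^ t" using k by (simp add: power_divide)
    also have "\<dots> \<le> real t ^ t * real (d p choose t)"
      using binomial_ge_n_over_k_pow_k[OF td, where ?'a = real] by (intro mult_left_mono) auto
    finally show ?thesis .
  qed
  have "N * B powr (real t / real k) = N * B * B powr (real t / real k - 1)"
    using Bpos by (simp add: powr_diff)
  also have "\<dots> \<le> (\<Sum>p\<in>Q. real (d p) ^ k) * B powr (real t / real k - 1)"
    using large by (intro mult_right_mono) auto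
  also have "\<dots> \<le> (\<Sum>p\<in>Q. real t ^ t * real (d p choose t))"
    unfolding sum_distrib_right by (intro sum_mono binom)
  also have "\<dots> \<le> (\<Sum>p\<in>P. real t ^ t * real (d p choose t))"
    by (rule sum_mono2) (use assms(1) in \<open>auto simp: Q_def\<close>)
  finally show ?thesis by (simp add: sum_distrib_left)
qed

lemma bipartite_copies_ge:
  fixes G :: "'a sgraph" and A :: real
  assumes G: "finite_simple_graph G" "card (verts G) = n" "0 < n" and k: "1 \<le> k" "k \<le> t"
    and paths: "A * real n ^ (k + 1) \<le> real (num_copies (path_graph (2 * k + 1)) G)"
    and A: "2 * real k * real t ^ k \<le> A"
  shows "real n ^ 2 * (A / (2 * real k)) powr (real t / real k)
           \<le> real t ^ t * real (t + 2) ^ 2 * real (num_copies (complete_bipartite 2 t) G)"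
proof -
  let ?P = "distinct_pairs G"
  let ?d = "\<lambda>p. codegree G (fst p) (snd p)"
  define M where "M = (\<Sum>p\<in>?P. real (?d p) ^ k)"
  have "real (num_copies (path_graph (2 * k + 1)) G)
      \<le> real (k * card (verts G) ^ (k - 1) * (\<Sum>(u, v)\<in>?P. codegree G u v ^ k))"
    using path_copies_le_codegree_moment[OF G(1) k(1)] by (simp only: of_nat_le_iff)
  also have "\<dots> = real k * real n ^ (k - 1) * M" by (simp add: M_def G(2) case_prod_beta)
  finally have "A * real n ^ (k + 1) \<le> real k * real n ^ (k - 1) * M" using paths by linarith
  moreover have "real n ^ (k + 1) = real n ^ (k - 1) * real n ^ 2"
    using k(1) by (simp flip: power_add)
  ultimately have "real n ^ (k - 1) * (A * real n ^ 2) \<le> real n ^ (k - 1) * (real k * M)"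
    by (simp add: mult_ac)
  hence "A * real n ^ 2 \<le> real k * M" using G(3) by simp
  \<comment> \<open>With threshold \<open>A / (2 * k)\<close> the small summands use up at most half of the moment.\<close>
  hence "2 * real n ^ 2 * (A / (2 * real k)) \<le> M" using k by (simp add: field_simps)
  moreover have "real t ^ k \<le> A / (2 * real k)" using A k by (simp add: field_simps)
  moreover have "real (card ?P) \<le> real n ^ 2"
    using card_distinct_pairs_le[OF G(1)] G(2) by (metis of_nat_le_iff of_nat_power)
  ultimately have "real n ^ 2 * (A / (2 * real k)) powr (real t / real k)
      \<le> real t ^ t * (\<Sum>p\<in>?P. real (?d p choose t))"
    using finite_distinct_pairs[OF G(1)] k unfolding M_def by (intro sum_binomial_ge) auto
  also have "(\<Sum>p\<in>?P. real (?d p choose t)) = real (\<Sum>(u, v)\<in>?P. codegree G u v choose t)"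
    by (simp add: case_prod_beta)
  also have "real t ^ t * \<dots> \<le> real t ^ t * real ((t + 2) ^ 2 * num_copies (complete_bipartite 2 t) G)"
    using sum_binomial_codegree_le_copies[OF G(1)] by (intro mult_left_mono) (simp_all only: of_nat_le_iff, simp)
  finally show ?thesis by (simp add: mult_ac)
qed

theorem theorem7p1:
  fixes k t :: nat
  assumes "1 \<le> k" and "k \<le> t"
  shows "\<exists>c::real. c > 0 \<and>
    (\<forall>m :: nat \<Rightarrow> nat.
       filterlim (\<lambda>n. real (m n) / real n ^ (k + 1)) at_top sequentially \<longrightarrow>
       (\<forall>\<^sub>F n in sequentially.
          satex_graphs n (path_graph (2 * k + 1)) (m n) \<noteq> {} \<longrightarrow>
          real (satex n (path_graph (2 * k + 1)) (m n) (complete_bipartite 2 t))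
            \<ge> c * (real n ^ 2 * (real (m n) / real n ^ (k + 1)) powr (real t / real k))))"
proof -
  define D where "D = real t ^ t * real (t + 2) ^ 2"
  define c where "c = (1 / (2 * real k)) powr (real t / real k) / D"
  have Dpos: "0 < D" using assms by (simp add: D_def)
  hence cpos: "0 < c" using assms by (simp add: c_def)
  show ?thesis
  proof (intro exI conjI allI impI)
    show "0 < c" by (rule cpos)
    fix m :: "nat \<Rightarrow> nat"
    assume "filterlim (\<lambda>n. real (m n) / real n ^ (k + 1)) at_top sequentially"
    hence "\<forall>\<^sub>F n in sequentially. 2 * real k * real t ^ k \<le> real (m n) / real n ^ (k + 1)"
      by (simp add: filterlim_at_top)
    thus "\<forall>\<^sub>F n in sequentially.
          satex_graphs n (path_graph (2 * k + 1)) (m n) \<noteq> {} \<longrightarrow>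
          real (satex n (path_graph (2 * k + 1)) (m n) (complete_bipartite 2 t))
            \<ge> c * (real n ^ 2 * (real (m n) / real n ^ (k + 1)) powr (real t / real k))"
      using eventually_gt_at_top[of 0]
    proof eventually_elim
      case (elim n)
      show ?case
      proof
        assume nonempty: "satex_graphs n (path_graph (2 * k + 1)) (m n) \<noteq> {}"
        define A where "A = real (m n) / real n ^ (k + 1)"
        have A: "2 * real k * real t ^ k \<le> A" using elim by (simp add: A_def)
        hence A0: "0 \<le> A" by (simp add: A_def)
        from nonempty have "satex n (path_graph (2 * k + 1)) (m n) (complete_bipartite 2 t)
            \<in> num_copies (complete_bipartite 2 t) ` satex_graphs n (path_graph (2 * k + 1)) (m n)"
          unfolding satex_def by (intro Inf_nat_def1) simp
        then obtain G where GS: "G \<in> satex_graphs n (path_graph (2 * k + 1)) (m n)"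
          and eq: "satex n (path_graph (2 * k + 1)) (m n) (complete_bipartite 2 t)
            = num_copies (complete_bipartite 2 t) G"
          by (elim imageE)
        from GS have G: "finite_simple_graph G" "card (verts G) = n"
            "m n \<le> num_copies (path_graph (2 * k + 1)) G"
          by (simp_all add: satex_graphs_def)
        have "A * real n ^ (k + 1) = real (m n)" using elim(2) by (simp add: A_def)
        hence "A * real n ^ (k + 1) \<le> real (num_copies (path_graph (2 * k + 1)) G)"
          using G(3) by simp
        from bipartite_copies_ge[OF G(1,2) elim(2) assms this A]
        have bound: "real n ^ 2 * (A / (2 * real k)) powr (real t / real k)
            \<le> D * real (num_copies (complete_bipartite 2 t) G)"
          by (simp add: D_def)
        have "c * (real n ^ 2 * A powr (real t / real k))
            = real n ^ 2 * (A * (1 / (2 * real k))) powr (real t / real k) / D"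
          using A0 by (subst powr_mult) (auto simp: c_def)
        also have "\<dots> \<le> real (num_copies (complete_bipartite 2 t) G)"
          using bound Dpos by (simp add: field_simps)
        finally show "c * (real n ^ 2 * (real (m n) / real n ^ (k + 1)) powr (real t / real k))
            \<le> real (satex n (path_graph (2 * k + 1)) (m n) (complete_bipartite 2 t))"
          unfolding A_def eq .
      qed
    qed
  qed
qed

end
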